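(* For any integer $m\geqslant0$: (1) there exists a square-free multipermutation cycle set of level $m$ and size $2^m$; (2) one has $N_{m+1}\leqslant2N_m$, where $N_m$ denotes the minimal size of square-free multipermutation cycle sets of level $m$.
   Context: A cycle set is a set $X$ with a binary operation $\cdot$ satisfying $(a\cdot b)\cdot(a\cdot c)=(b\cdot a)\cdot(b\cdot c)$ and such that all left translations $a\mapsto b\cdot a$ are bijective. It is non-degenerate if the squaring map $a\mapsto a\cdot a$ is bijective, and square-free if $a\cdot a=a$ for all $a$ (square-free implies non-degenerate). For a non-degenerate cycle set $(X,\cdot)$, let $a\approx a'$ iff $a\cdot b=a'\cdot b$ for all $b\in X$. It is known that $\cdot$ induces a non-degenerate cycle set structure on $X/\approx$, called the retraction $\operatorname{Ret}(X,\cdot)$. A non-degenerate cycle set is multipermutation of level $n\geqslant0$ if $n$ is the minimal number such that $|\operatorname{Ret}^n(X,\cdot)|=1$. *)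

theory Defs
  imports Main
begin

record 'a cyc_struct =
  carrier :: "'a set"
  op :: "'a \<Rightarrow> 'a \<Rightarrow> 'a" (infixl "\<cdot>\<index>" 70)

locale cycle_set =
  fixes S :: "'a cyc_struct" (structure)
  assumes left_translation_bij: "b \<in> carrier S \<Longrightarrow> bij_betw (\<lambda>a. b \<cdot> a) (carrier S) (carrier S)"
    and cycle_law: "\<lbrakk>a \<in> carrier S; b \<in> carrier S; c \<in> carrier S\<rbrakk>
      \<Longrightarrow> (a \<cdot> b) \<cdot> (a \<cdot> c) = (b \<cdot> a) \<cdot> (b \<cdot> c)"

locale nondegenerate_cycle_set = cycle_set +
  assumes squaring_bij: "bij_betw (\<lambda>a. a \<cdot> a) (carrier S) (carrier S)"

locale square_free_cycle_set = cycle_set +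
  assumes square_free: "a \<in> carrier S \<Longrightarrow> a \<cdot> a = a"

sublocale square_free_cycle_set \<subseteq> nondegenerate_cycle_set
proof
  show "bij_betw (\<lambda>a. a \<cdot> a) (carrier S) (carrier S)"
    using bij_betw_cong[of "carrier S" "\<lambda>a. a \<cdot> a" id] square_free by simp
qed

definition retract_rel :: "'a cyc_struct \<Rightarrow> ('a \<times> 'a) set" where
  "retract_rel S = {(a, a'). a \<in> carrier S \<and> a' \<in> carrier S \<and>
     (\<forall>b \<in> carrier S. a \<cdot>\<^bsub>S\<^esub> b = a' \<cdot>\<^bsub>S\<^esub> b)}"

text \<open>The union in the operation of \<open>Ret S\<close> is the single class of \<open>a \<cdot> b\<close>, for any
  \<open>a \<in> A\<close> and \<open>b \<in> B\<close>; see \<open>Ret_op\<close> below.\<close>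

definition Ret :: "'a cyc_struct \<Rightarrow> 'a set cyc_struct" where
  "Ret S = \<lparr>carrier = carrier S // retract_rel S,
     op = (\<lambda>A B. \<Union>a\<in>A. \<Union>b\<in>B. retract_rel S `` {a \<cdot>\<^bsub>S\<^esub> b})\<rparr>"

lemma equiv_retract_rel: "equiv (carrier S) (retract_rel S)"
  by (rule equivI) (auto simp: retract_rel_def refl_on_def sym_def trans_def)

text \<open>Surjective left translations suffice for the induced operation to be well defined, and
  this weaker structure visibly passes to \<open>Ret\<close>.\<close>

locale surj_cycle_set =
  fixes S :: "'a cyc_struct" (structure)
  assumes left_translation_image: "b \<in> carrier S \<Longrightarrow> (\<lambda>a. b \<cdot> a) ` carrier S = carrier S"
    and cycle_law: "\<lbrakk>a \<in> carrier S; b \<in> carrier S; c \<in> carrier S\<rbrakk>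
      \<Longrightarrow> (a \<cdot> b) \<cdot> (a \<cdot> c) = (b \<cdot> a) \<cdot> (b \<cdot> c)"

sublocale cycle_set \<subseteq> surj_cycle_set
  by unfold_locales (use left_translation_bij cycle_law in \<open>auto simp: bij_betw_def\<close>)

context surj_cycle_set
begin

lemma op_closed: "\<lbrakk>a \<in> carrier S; b \<in> carrier S\<rbrakk> \<Longrightarrow> a \<cdot> b \<in> carrier S"
  using left_translation_image by blast

lemma retract_rel_congruent:
  assumes "(a, a') \<in> retract_rel S" "(b, b') \<in> retract_rel S"
  shows "(a \<cdot> b, a' \<cdot> b') \<in> retract_rel S"
proof -
  have c: "a \<in> carrier S" "a' \<in> carrier S" "b \<in> carrier S" "b' \<in> carrier S"
    using assms by (auto simp: retract_rel_def)
  have "(a \<cdot> b) \<cdot> d = (a' \<cdot> b') \<cdot> d" if "d \<in> carrier S" for d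
  proof -
    from that obtain e where e: "e \<in> carrier S" "d = a \<cdot> e"
      using left_translation_image[OF c(1)] by blast
    have "(a \<cdot> b) \<cdot> (a \<cdot> e) = (b \<cdot> a) \<cdot> (b \<cdot> e)"
      using c e cycle_law by simp
    also have "\<dots> = (b' \<cdot> a) \<cdot> (b' \<cdot> e)"
      using assms(2) c e by (simp add: retract_rel_def)
    also have "\<dots> = (a \<cdot> b') \<cdot> (a \<cdot> e)"
      using c e cycle_law by simp
    also have "a \<cdot> b' = a' \<cdot> b'"
      using assms(1) c by (simp add: retract_rel_def)
    finally show ?thesis using e by simp
  qed
  then show ?thesis using c op_closed by (simp add: retract_rel_def)
qed

lemma Ret_op:
  assumes "a \<in> carrier S" "b \<in> carrier S"
  shows "(retract_rel S `` {a}) \<cdot>\<^bsub>Ret S\<^esub> (retract_rel S `` {b}) = retract_rel S `` {a \<cdot> b}"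
proof -
  have cong: "congruent2 (retract_rel S) (retract_rel S) (\<lambda>x y. retract_rel S `` {x \<cdot> y})"
  proof (rule congruent2I')
    fix x x' y y' assume "(x, x') \<in> retract_rel S" "(y, y') \<in> retract_rel S"
    then show "retract_rel S `` {x \<cdot> y} = retract_rel S `` {x' \<cdot> y'}"
      by (intro equiv_class_eq[OF equiv_retract_rel] retract_rel_congruent)
  qed
  show ?thesis
    unfolding Ret_def cyc_struct.simps
    by (rule UN_equiv_class2[OF equiv_retract_rel equiv_retract_rel cong assms])
qed

end

text \<open>\<open>Ret\<close> changes the type of elements and so cannot be iterated as it stands.
  \<open>Ret_copy S\<close> is \<open>Ret S\<close> transported along a choice of one representative in each class,
  hence an isomorphic copy of \<open>Ret S\<close> whose elements have the type of those of \<open>S\<close>.\<close>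

definition transport :: "('a \<Rightarrow> 'b) \<Rightarrow> 'a cyc_struct \<Rightarrow> 'b cyc_struct" where
  "transport f S = \<lparr>carrier = f ` carrier S,
     op = (\<lambda>x y. f (inv_into (carrier S) f x \<cdot>\<^bsub>S\<^esub> inv_into (carrier S) f y))\<rparr>"

definition Ret_copy :: "'a cyc_struct \<Rightarrow> 'a cyc_struct" where
  "Ret_copy S = transport (\<lambda>A. SOME a. a \<in> A) (Ret S)"

definition cyc_iso :: "('a \<Rightarrow> 'b) \<Rightarrow> 'a cyc_struct \<Rightarrow> 'b cyc_struct \<Rightarrow> bool" where
  "cyc_iso f S T \<longleftrightarrow> bij_betw f (carrier S) (carrier T) \<and>
     (\<forall>a \<in> carrier S. \<forall>b \<in> carrier S. f (a \<cdot>\<^bsub>S\<^esub> b) = f a \<cdot>\<^bsub>T\<^esub> f b)"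

lemma cyc_iso_transport: "inj_on f (carrier S) \<Longrightarrow> cyc_iso f S (transport f S)"
  by (simp add: cyc_iso_def transport_def bij_betw_def)

lemma cyc_iso_Ret_copy: "cyc_iso (\<lambda>A. SOME a. a \<in> A) (Ret S) (Ret_copy S)"
  unfolding Ret_copy_def
proof (rule cyc_iso_transport, rule inj_onI)
  fix A B
  assume AB: "A \<in> carrier (Ret S)" "B \<in> carrier (Ret S)"
    and eq: "(SOME a. a \<in> A) = (SOME b. b \<in> B)"
  then have Q: "A \<in> carrier S // retract_rel S" "B \<in> carrier S // retract_rel S"
    by (simp_all add: Ret_def)
  then have "A \<noteq> {}" "B \<noteq> {}"
    using in_quotient_imp_non_empty[OF equiv_retract_rel] by blast+
  then have "(SOME a. a \<in> A) \<in> A" "(SOME b. b \<in> B) \<in> B"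
    by (simp_all only: some_in_eq simp_thms)
  then have "A \<inter> B \<noteq> {}"
    unfolding eq by blast
  then show "A = B"
    using quotient_disj[OF equiv_retract_rel Q] by blast
qed

text \<open>The size of the \<open>n\<close>-th iterated retraction does not depend on the representatives.
  As \<open>card\<close> is zero on infinite sets, cardinality one really means a one-element set.\<close>

definition multipermutation_of_level :: "nat \<Rightarrow> 'a cyc_struct \<Rightarrow> bool" where
  "multipermutation_of_level n S \<longleftrightarrow> nondegenerate_cycle_set S \<and>
     card (carrier ((Ret_copy ^^ n) S)) = 1 \<and>
     (\<forall>k < n. card (carrier ((Ret_copy ^^ k) S)) \<noteq> 1)"

text \<open>The minimal size is attained by finite structures, and every finite structure is
  isomorphic to one with carrier in \<open>nat\<close>; see \<open>min_size_le\<close> below.\<close>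

definition min_size :: "nat \<Rightarrow> nat" where
  "min_size m = (LEAST k. \<exists>S :: nat cyc_struct. square_free_cycle_set S \<and>
     multipermutation_of_level m S \<and> finite (carrier S) \<and> card (carrier S) = k)"

lemma surj_cycle_set_Ret:
  fixes S (structure)
  assumes "surj_cycle_set S"
  shows "surj_cycle_set (Ret S)"
proof -
  interpret surj_cycle_set S by fact
  have car: "carrier (Ret S) = (\<lambda>a. retract_rel S `` {a}) ` carrier S"
    by (simp_all add: Ret_def quotient_def UNION_singleton_eq_range)
  show ?thesis
  proof
    fix A assume "A \<in> carrier (Ret S)"
    then obtain a where a: "a \<in> carrier S" "A = retract_rel S `` {a}"
      using car by blast
    have "(\<lambda>B. A \<cdot>\<^bsub>Ret S\<^esub> B) ` carrier (Ret S)
        = (\<lambda>b. retract_rel S `` {b}) ` (\<lambda>b. a \<cdot> b) ` carrier S"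
      unfolding car image_image by (rule image_cong) (auto simp: a Ret_op)
    also have "\<dots> = carrier (Ret S)"
      by (simp only: left_translation_image[OF a(1)] car)
    finally show "(\<lambda>B. A \<cdot>\<^bsub>Ret S\<^esub> B) ` carrier (Ret S) = carrier (Ret S)" .
  next
    fix A B C assume "A \<in> carrier (Ret S)" "B \<in> carrier (Ret S)" "C \<in> carrier (Ret S)"
    then obtain a b c where abc: "a \<in> carrier S" "b \<in> carrier S" "c \<in> carrier S"
      "A = retract_rel S `` {a}" "B = retract_rel S `` {b}" "C = retract_rel S `` {c}"
      unfolding car by blast
    with cycle_law[OF abc(1-3)]
    show "(A \<cdot>\<^bsub>Ret S\<^esub> B) \<cdot>\<^bsub>Ret S\<^esub> (A \<cdot>\<^bsub>Ret S\<^esub> C)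
        = (B \<cdot>\<^bsub>Ret S\<^esub> A) \<cdot>\<^bsub>Ret S\<^esub> (B \<cdot>\<^bsub>Ret S\<^esub> C)"
      by (simp add: Ret_op op_closed)
  qed
qed

lemma surj_cycle_set_iso:
  fixes S (structure)
  assumes "surj_cycle_set S" "cyc_iso f S T"
  shows "surj_cycle_set T"
proof -
  interpret surj_cycle_set S by fact
  have car: "carrier T = f ` carrier S"
    and hom: "\<And>a b. \<lbrakk>a \<in> carrier S; b \<in> carrier S\<rbrakk> \<Longrightarrow> f a \<cdot>\<^bsub>T\<^esub> f b = f (a \<cdot> b)"
    using assms(2) by (simp_all add: cyc_iso_def bij_betw_def)
  show ?thesis
  proof
    fix y assume "y \<in> carrier T"
    then obtain b where b: "b \<in> carrier S" "y = f b" using car by blast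
    have "(\<lambda>x. y \<cdot>\<^bsub>T\<^esub> x) ` carrier T = f ` (\<lambda>a. b \<cdot> a) ` carrier S"
      unfolding car image_image by (rule image_cong) (auto simp: b hom)
    also have "\<dots> = carrier T"
      by (simp only: left_translation_image[OF b(1)] car)
    finally show "(\<lambda>x. y \<cdot>\<^bsub>T\<^esub> x) ` carrier T = carrier T" .
  next
    fix x y z assume "x \<in> carrier T" "y \<in> carrier T" "z \<in> carrier T"
    then obtain a b c where abc: "a \<in> carrier S" "b \<in> carrier S" "c \<in> carrier S"
      "x = f a" "y = f b" "z = f c"
      unfolding car by blast
    with cycle_law[OF abc(1-3)]
    show "(x \<cdot>\<^bsub>T\<^esub> y) \<cdot>\<^bsub>T\<^esub> (x \<cdot>\<^bsub>T\<^esub> z) = (y \<cdot>\<^bsub>T\<^esub> x) \<cdot>\<^bsub>T\<^esub> (y \<cdot>\<^bsub>T\<^esub> z)"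
      by (simp add: hom op_closed)
  qed
qed

lemma cyc_iso_trans:
  assumes "cyc_iso f S T" "cyc_iso g T U"
  shows "cyc_iso (g \<circ> f) S U"
proof -
  have "f a \<in> carrier T" if "a \<in> carrier S" for a
    using assms(1) that bij_betwE unfolding cyc_iso_def by blast
  then show ?thesis
    using assms unfolding cyc_iso_def by (simp add: bij_betw_trans[of f "carrier S" "carrier T" g])
qed

lemma cyc_iso_sym:
  fixes S (structure)
  assumes "surj_cycle_set S" "cyc_iso f S T"
  shows "cyc_iso (inv_into (carrier S) f) T S"
proof -
  interpret surj_cycle_set S by fact
  have inj: "inj_on f (carrier S)" and car: "carrier T = f ` carrier S"
    and hom: "\<And>a b. \<lbrakk>a \<in> carrier S; b \<in> carrier S\<rbrakk> \<Longrightarrow> f a \<cdot>\<^bsub>T\<^esub> f b = f (a \<cdot> b)"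
    using assms(2) by (simp_all add: cyc_iso_def bij_betw_def)
  have "bij_betw (inv_into (carrier S) f) (carrier T) (carrier S)"
    using assms(2) by (simp add: cyc_iso_def bij_betw_inv_into)
  then show ?thesis
    unfolding cyc_iso_def by (auto simp: car hom inj op_closed)
qed

lemma cyc_iso_Ret:
  assumes "surj_cycle_set S" "cyc_iso f S T"
  shows "cyc_iso (image f) (Ret S) (Ret T)"
proof -
  interpret S: surj_cycle_set S by fact
  interpret T: surj_cycle_set T using surj_cycle_set_iso assms .
  have inj: "inj_on f (carrier S)" and car: "carrier T = f ` carrier S"
    and hom: "\<And>a b. \<lbrakk>a \<in> carrier S; b \<in> carrier S\<rbrakk> \<Longrightarrow> f a \<cdot>\<^bsub>T\<^esub> f b = f (a \<cdot>\<^bsub>S\<^esub> b)"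
    using assms(2) by (simp_all add: cyc_iso_def bij_betw_def)
  have rel: "(f a, f b) \<in> retract_rel T \<longleftrightarrow> (a, b) \<in> retract_rel S"
    if "a \<in> carrier S" "b \<in> carrier S" for a b
    using that by (auto simp: retract_rel_def car hom S.op_closed inj_on_eq_iff[OF inj])
  have cls: "f ` (retract_rel S `` {a}) = retract_rel T `` {f a}" if a: "a \<in> carrier S" for a
  proof
    show "f ` (retract_rel S `` {a}) \<subseteq> retract_rel T `` {f a}"
      using a by (auto simp: rel retract_rel_def car hom)
    show "retract_rel T `` {f a} \<subseteq> f ` (retract_rel S `` {a})"
    proof
      fix y assume y: "y \<in> retract_rel T `` {f a}"
      then obtain b where b: "b \<in> carrier S" "y = f b"
        by (auto simp: retract_rel_def car)
      then show "y \<in> f ` (retract_rel S `` {a})" using y rel[OF a b(1)] by auto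
    qed
  qed
  have carS: "carrier (Ret S) = (\<lambda>a. retract_rel S `` {a}) ` carrier S"
    and carT: "carrier (Ret T) = (\<lambda>a. retract_rel T `` {a}) ` carrier T"
    by (simp_all add: Ret_def quotient_def UNION_singleton_eq_range)
  have "inj_on (image f) (carrier (Ret S))"
    by (rule inj_on_subset[OF inj_on_image_Pow[OF inj]]) (auto simp: carS retract_rel_def)
  moreover have "image f ` carrier (Ret S) = carrier (Ret T)"
    unfolding carS carT car image_image using cls by (rule image_cong[OF refl])
  moreover have "f ` (A \<cdot>\<^bsub>Ret S\<^esub> B) = f ` A \<cdot>\<^bsub>Ret T\<^esub> f ` B"
    if AB: "A \<in> carrier (Ret S)" "B \<in> carrier (Ret S)" for A B
  proof -
    obtain a b where "a \<in> carrier S" "b \<in> carrier S"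
      "A = retract_rel S `` {a}" "B = retract_rel S `` {b}"
      using AB unfolding carS by blast
    then show ?thesis
      by (simp only: S.Ret_op T.Ret_op cls hom S.op_closed car imageI)
  qed
  ultimately show ?thesis by (simp add: cyc_iso_def bij_betw_def)
qed

lemma cyc_iso_funpow_Ret_copy:
  assumes "surj_cycle_set S" "cyc_iso f S T"
  shows "surj_cycle_set ((Ret_copy ^^ n) S) \<and> (\<exists>g. cyc_iso g ((Ret_copy ^^ n) S) ((Ret_copy ^^ n) T))"
proof (induction n)
  case 0
  then show ?case using assms by auto
next
  case (Suc n)
  let ?S = "(Ret_copy ^^ n) S" and ?T = "(Ret_copy ^^ n) T"
  from Suc obtain g where g: "surj_cycle_set ?S" "cyc_iso g ?S ?T" by blast
  note R = surj_cycle_set_Ret[OF g(1)]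
  have "\<exists>h. cyc_iso h (Ret_copy ?S) (Ret_copy ?T)"
    by (intro exI) (rule cyc_iso_trans[OF cyc_iso_sym[OF R cyc_iso_Ret_copy]
      cyc_iso_trans[OF cyc_iso_Ret[OF g] cyc_iso_Ret_copy]])
  then show ?case
    unfolding funpow.simps o_apply using surj_cycle_set_iso[OF R cyc_iso_Ret_copy] by (rule conjI[rotated])
qed

lemma square_free_cycle_set_iso:
  fixes S (structure)
  assumes "square_free_cycle_set S" "cyc_iso f S T"
  shows "square_free_cycle_set T"
proof -
  interpret square_free_cycle_set S by fact
  interpret T: surj_cycle_set T
    using surj_cycle_set_iso[OF surj_cycle_set_axioms assms(2)] .
  have inj: "inj_on f (carrier S)" and car: "carrier T = f ` carrier S"
    and hom: "\<And>a b. \<lbrakk>a \<in> carrier S; b \<in> carrier S\<rbrakk> \<Longrightarrow> f a \<cdot>\<^bsub>T\<^esub> f b = f (a \<cdot> b)"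
    using assms(2) by (simp_all add: cyc_iso_def bij_betw_def)
  show ?thesis
  proof unfold_locales
    fix y assume y: "y \<in> carrier T"
    then obtain b where b: "b \<in> carrier S" "y = f b" using car by blast
    have "inj_on (\<lambda>x. y \<cdot>\<^bsub>T\<^esub> x) (carrier T)"
    proof (rule inj_onI)
      fix u v assume "u \<in> carrier T" "v \<in> carrier T" and eq: "y \<cdot>\<^bsub>T\<^esub> u = y \<cdot>\<^bsub>T\<^esub> v"
      then obtain c d where cd: "c \<in> carrier S" "u = f c" "d \<in> carrier S" "v = f d"
        using car by blast
      then have "b \<cdot> c = b \<cdot> d"
        using inj_onD[OF inj, of "b \<cdot> c" "b \<cdot> d"] eq b(2)
        by (simp only: hom[OF b(1)] op_closed[OF b(1)])
      then show "u = v"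
        using inj_onD[OF bij_betw_imp_inj_on[OF left_translation_bij[OF b(1)]]] cd by blast
    qed
    then show "bij_betw (\<lambda>x. y \<cdot>\<^bsub>T\<^esub> x) (carrier T) (carrier T)"
      using T.left_translation_image[OF y] by (simp add: bij_betw_def)
    show "y \<cdot>\<^bsub>T\<^esub> y = y" using b hom square_free by simp
  qed (rule T.cycle_law)
qed

lemma min_size_le:
  fixes S :: "'a cyc_struct"
  assumes "square_free_cycle_set S" "multipermutation_of_level m S" "finite (carrier S)"
  shows "min_size m \<le> card (carrier S)"
proof -
  interpret square_free_cycle_set S by fact
  obtain f :: "'a \<Rightarrow> nat" where f: "inj_on f (carrier S)"
    using finite_imp_inj_to_nat_seg[OF assms(3)] by blast
  define T where "T = transport f S"
  have iso: "cyc_iso f S T" using cyc_iso_transport[OF f] by (simp add: T_def)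
  have sf: "square_free_cycle_set T" using square_free_cycle_set_iso[OF assms(1) iso] .
  have "card (carrier ((Ret_copy ^^ k) T)) = card (carrier ((Ret_copy ^^ k) S))" for k
    using cyc_iso_funpow_Ret_copy[OF surj_cycle_set_axioms iso, of k]
    by (auto simp: cyc_iso_def dest: bij_betw_same_card)
  moreover have "nondegenerate_cycle_set T"
  proof -
    interpret T: square_free_cycle_set T by (rule sf)
    show ?thesis by (rule T.nondegenerate_cycle_set_axioms)
  qed
  ultimately have "multipermutation_of_level m T"
    using assms(2) by (simp add: multipermutation_of_level_def)
  moreover have "finite (carrier T)" "card (carrier T) = card (carrier S)"
    using assms(3) card_image[OF f] by (simp_all add: T_def transport_def)
  ultimately show ?thesis
    unfolding min_size_def using sf by (intro Least_le) blast
qed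

end

(* Extend a square-free cycle set X by Z/2 along the cocycle f(x, y) = [x \<noteq> y]: put
   (x, a) (y, b) = (x y, b + f(x, y)) on X \<times> Z/2.  The cocycle condition
   f(xy, xz) + f(x, z) = f(yx, yz) + f(y, z) holds because left translations are injective, and
   f(x, x) = 0 keeps the extension square-free.  As f(x, _) determines x, its retraction is
   exactly X again, so the size doubles while the level increases by one. *)
theory Submission
  imports Defs
begin

text \<open>\<open>bool\<close> plays the role of Z/2: \<open>b = (x = y)\<close> keeps
  \<open>b\<close> when \<open>x = y\<close> and negates it otherwise, which is adding the cocycle
  value. The bit \<open>a\<close> of the left factor is ignored.\<close>

definition double :: "'a cyc_struct \<Rightarrow> ('a \<times> bool) cyc_struct" where
  "double S = \<lparr>carrier = carrier S \<times> UNIV,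
     op = (\<lambda>(x, a) (y, b). (x \<cdot>\<^bsub>S\<^esub> y, b = (x = y)))\<rparr>"

lemma carrier_double [simp]: "carrier (double S) = carrier S \<times> UNIV"
  by (simp add: double_def)

lemma op_double [simp]: "(x, a) \<cdot>\<^bsub>double S\<^esub> (y, b) = (x \<cdot>\<^bsub>S\<^esub> y, b = (x = y))"
  by (simp add: double_def)

context cycle_set
begin

lemma left_cancel:
  "\<lbrakk>a \<in> carrier S; b \<in> carrier S; c \<in> carrier S\<rbrakk> \<Longrightarrow> a \<cdot> b = a \<cdot> c \<longleftrightarrow> b = c"
  using left_translation_bij[of a] by (auto simp: bij_betw_def inj_on_def)

lemma cycle_set_double: "cycle_set (double S)"
proof
  fix p assume "p \<in> carrier (double S)"
  then obtain x a where p: "p = (x, a)" "x \<in> carrier S" by auto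
  show "bij_betw (\<lambda>q. p \<cdot>\<^bsub>double S\<^esub> q) (carrier (double S)) (carrier (double S))"
  proof (rule bij_betw_imageI)
    show "inj_on (\<lambda>q. p \<cdot>\<^bsub>double S\<^esub> q) (carrier (double S))"
      by (rule inj_onI) (use p left_cancel in auto)
    show "(\<lambda>q. p \<cdot>\<^bsub>double S\<^esub> q) ` carrier (double S) = carrier (double S)"
    proof
      show "(\<lambda>q. p \<cdot>\<^bsub>double S\<^esub> q) ` carrier (double S) \<subseteq> carrier (double S)"
        using p op_closed by auto
      show "carrier (double S) \<subseteq> (\<lambda>q. p \<cdot>\<^bsub>double S\<^esub> q) ` carrier (double S)"
      proof
        fix r assume "r \<in> carrier (double S)"
        then obtain z c where r: "r = (z, c)" "z \<in> carrier S" by auto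
        then obtain y where y: "y \<in> carrier S" "z = x \<cdot> y"
          using left_translation_image[OF p(2)] by blast
        \<comment> \<open>For fixed \<open>x\<close> and \<open>y\<close> the action on the bit is
          an involution, so applying it to \<open>c\<close> gives the preimage bit.\<close>
        show "r \<in> (\<lambda>q. p \<cdot>\<^bsub>double S\<^esub> q) ` carrier (double S)"
          by (rule image_eqI[of _ _ "(y, c = (x = y))"]) (use p r y in auto)
      qed
    qed
  qed
next
  fix p q r
  assume "p \<in> carrier (double S)" "q \<in> carrier (double S)" "r \<in> carrier (double S)"
  \<comment> \<open>Write x, y, z for the first components and c for the bit of \<open>r\<close>. By
    \<open>left_cancel\<close>, the left side has bit c + [x \<noteq> z] + [y \<noteq> z], which is
    symmetric in x and y.\<close>
  then show "(p \<cdot>\<^bsub>double S\<^esub> q) \<cdot>\<^bsub>double S\<^esub> (p \<cdot>\<^bsub>double S\<^esub> r)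
      = (q \<cdot>\<^bsub>double S\<^esub> p) \<cdot>\<^bsub>double S\<^esub> (q \<cdot>\<^bsub>double S\<^esub> r)"
    using cycle_law left_cancel by auto
qed

lemma retract_rel_double_class:
  assumes "x \<in> carrier S"
  shows "retract_rel (double S) `` {(x, a)} = {x} \<times> UNIV"
proof -
  have "(y, b) \<in> retract_rel (double S) `` {(x, a)} \<longleftrightarrow> y = x" for y b
  proof
    assume "(y, b) \<in> retract_rel (double S) `` {(x, a)}"
    \<comment> \<open>Acting on \<open>(x, True)\<close> separates the fibres: the resulting bit is
      \<open>True\<close> on the left and \<open>y = x\<close> on the right.\<close>
    then have "(x, a) \<cdot>\<^bsub>double S\<^esub> (x, True) = (y, b) \<cdot>\<^bsub>double S\<^esub> (x, True)"
      using assms by (simp add: retract_rel_def del: op_double)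
    then show "y = x" by simp
  qed (use assms in \<open>simp add: retract_rel_def\<close>)
  then show ?thesis by auto
qed

lemma cyc_iso_Ret_double: "cyc_iso (\<lambda>x. {x} \<times> UNIV) S (Ret (double S))"
proof -
  interpret D: cycle_set "double S" by (rule cycle_set_double)
  have "carrier (Ret (double S)) = (\<lambda>x. {x} \<times> UNIV) ` carrier S"
    by (auto simp: Ret_def quotient_def retract_rel_double_class)
  moreover have "{x} \<times> UNIV \<cdot>\<^bsub>Ret (double S)\<^esub> {y} \<times> UNIV = {x \<cdot> y} \<times> UNIV"
    if "x \<in> carrier S" "y \<in> carrier S" for x y
    using D.Ret_op[of "(x, True)" "(y, True)"] that
    by (simp add: retract_rel_double_class op_closed)
  moreover have "inj_on (\<lambda>x. {x} \<times> (UNIV :: bool set)) (carrier S)"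
    by (rule inj_onI) blast
  ultimately show ?thesis
    by (simp add: cyc_iso_def bij_betw_def)
qed

end

lemma square_free_cycle_set_double:
  assumes "square_free_cycle_set S"
  shows "square_free_cycle_set (double S)"
proof -
  interpret square_free_cycle_set S by fact
  interpret D: cycle_set "double S" by (rule cycle_set_double)
  show ?thesis
    by unfold_locales (use square_free in auto)
qed

text \<open>The first retraction of \<open>double S\<close> is a copy of \<open>S\<close>, so the
  sizes of its iterated retractions are those for \<open>S\<close> shifted by one place.\<close>

lemma multipermutation_of_level_double:
  assumes "square_free_cycle_set S" "multipermutation_of_level m S"
  shows "multipermutation_of_level (Suc m) (double S)"
proof -
  interpret square_free_cycle_set S by fact
  interpret D: square_free_cycle_set "double S"
    using assms(1) by (rule square_free_cycle_set_double)
  obtain f where iso: "cyc_iso f S (Ret_copy (double S))"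
    using cyc_iso_trans[OF cyc_iso_Ret_double cyc_iso_Ret_copy] by blast
  \<comment> \<open>\<open>funpow_Suc_right\<close> splits off the innermost retraction, the one
    that \<open>iso\<close> identifies with \<open>S\<close>.\<close>
  have step: "card (carrier ((Ret_copy ^^ Suc k) (double S))) = card (carrier ((Ret_copy ^^ k) S))"
    for k
    using cyc_iso_funpow_Ret_copy[OF surj_cycle_set_axioms iso, of k]
    by (auto simp: funpow_Suc_right cyc_iso_def simp del: funpow.simps
        dest: bij_betw_same_card)
  have "card (carrier ((Ret_copy ^^ k) (double S))) \<noteq> 1" if "k < Suc m" for k
  proof (cases k)
    case 0
    \<comment> \<open>The new initial term is twice a cardinality, hence even and not 1; this keeps
      the level minimal.\<close>
    then show ?thesis by (simp add: card_cartesian_product)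
  next
    case (Suc j)
    then show ?thesis
      using that assms(2) step[of j] by (simp add: multipermutation_of_level_def)
  qed
  then show ?thesis
    using assms(2) step[of m] D.nondegenerate_cycle_set_axioms
    by (simp add: multipermutation_of_level_def)
qed

text \<open>Isomorphisms persist through iterated retraction. This lets a doubled structure be moved
  back to carrier type \<open>nat\<close>.\<close>

lemma multipermutation_of_level_iso:
  assumes "square_free_cycle_set S" "multipermutation_of_level m S" "cyc_iso f S T"
  shows "multipermutation_of_level m T"
proof -
  interpret square_free_cycle_set S by fact
  interpret T: square_free_cycle_set T
    using square_free_cycle_set_iso[OF assms(1,3)] .
  have "card (carrier ((Ret_copy ^^ k) T)) = card (carrier ((Ret_copy ^^ k) S))" for k
    using cyc_iso_funpow_Ret_copy[OF surj_cycle_set_axioms assms(3), of k]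
    by (auto simp: cyc_iso_def dest: bij_betw_same_card)
  then show ?thesis
    using assms(2) T.nondegenerate_cycle_set_axioms
    by (simp add: multipermutation_of_level_def)
qed

lemma ex_square_free_level_card_power_2:
  "\<exists>S :: nat cyc_struct. square_free_cycle_set S \<and> multipermutation_of_level m S \<and>
     finite (carrier S) \<and> card (carrier S) = 2 ^ m"
proof (induction m)
  case 0
  \<comment> \<open>The one-point structure has level 0: its size is already 1 and no smaller
    \<open>k\<close> has to be excluded.\<close>
  let ?S = "\<lparr>carrier = {0}, op = (\<lambda>x y. 0)\<rparr> :: nat cyc_struct"
  interpret square_free_cycle_set ?S
    by unfold_locales (auto simp: bij_betw_def)
  show ?case
    by (rule exI[of _ ?S])
      (use square_free_cycle_set_axioms nondegenerate_cycle_set_axioms in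
        \<open>simp add: multipermutation_of_level_def\<close>)
next
  case (Suc m)
  then obtain S :: "nat cyc_struct" where S: "square_free_cycle_set S"
    "multipermutation_of_level m S" "finite (carrier S)" "card (carrier S) = 2 ^ m"
    by blast
  have fin: "finite (carrier (double S))"
    using S(3) by simp
  \<comment> \<open>Relabelling the pairs by naturals keeps the type fixed throughout the
    induction.\<close>
  then obtain f :: "nat \<times> bool \<Rightarrow> nat" where f: "inj_on f (carrier (double S))"
    using finite_imp_inj_to_nat_seg by blast
  note D = square_free_cycle_set_double[OF S(1)] and iso = cyc_iso_transport[OF f]
  have "card (carrier (transport f (double S))) = card (carrier (double S))"
    using card_image[OF f] by (simp add: transport_def)
  also have "\<dots> = 2 ^ Suc m"
    using S(4) by (simp add: card_cartesian_product)
  finally have "card (carrier (transport f (double S))) = 2 ^ Suc m" .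
  moreover have "finite (carrier (transport f (double S)))"
    using fin by (simp add: transport_def)
  ultimately show ?case
    using square_free_cycle_set_iso[OF D iso]
      multipermutation_of_level_iso[OF D multipermutation_of_level_double[OF S(1,2)] iso]
    by blast
qed

text \<open>The \<open>LEAST\<close> in \<open>min_size\<close> is a true minimum because the
  structures of size \<open>2 ^ m\<close> make its set of candidates nonempty.\<close>

lemma min_size_attained:
  obtains S :: "nat cyc_struct" where "square_free_cycle_set S" "multipermutation_of_level m S"
    "finite (carrier S)" "card (carrier S) = min_size m"
proof -
  have "\<exists>k. \<exists>S :: nat cyc_struct. square_free_cycle_set S \<and> multipermutation_of_level m S \<and>
      finite (carrier S) \<and> card (carrier S) = k"
    using ex_square_free_level_card_power_2 by blast
  from LeastI_ex[OF this] show ?thesis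
    using that unfolding min_size_def by blast
qed

theorem corollary10p7:
  fixes m :: nat
  shows "(\<exists>S :: nat cyc_struct. square_free_cycle_set S \<and> multipermutation_of_level m S \<and>
            finite (carrier S) \<and> card (carrier S) = 2 ^ m)
       \<and> min_size (m + 1) \<le> 2 * min_size m"
proof
  obtain S :: "nat cyc_struct" where S: "square_free_cycle_set S" "multipermutation_of_level m S"
    "finite (carrier S)" "card (carrier S) = min_size m"
    by (rule min_size_attained)
  \<comment> \<open>Doubling a minimal structure gives the bound; \<open>min_size_le\<close> accepts
    any element type, so no relabelling is done here.\<close>
  have "min_size (m + 1) \<le> card (carrier (double S))"
    using square_free_cycle_set_double[OF S(1)] multipermutation_of_level_double[OF S(1,2)] S(3)
    by (intro min_size_le) simp_all
  then show "min_size (m + 1) \<le> 2 * min_size m"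
    using S(4) by (simp add: card_cartesian_product)
qed (rule ex_square_free_level_card_power_2)

end
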